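(* Let $m\ge 1$ be an integer, let $q\ge 0$ be real, and let $\mathbf w=[w_1,\ldots,w_m]$ be a vector of positive real numbers which is ascendingly ordered, i.e. $w_1\le w_2\le\cdots\le w_m$. Then the cardinality of the set \[ X_{\mathbf w}(q,m)=\Big\{\boldsymbol\alpha\in\mathbb N^m:\sum_{n=1}^m\alpha_nw_n\le q\Big\} \] is bounded by \[ \# X_{\mathbf w}(q,m)\le\prod_{n=1}^m\bigg(\frac{q}{n\,w_n}+1\bigg). \]
   Context: $\mathbb N=\{0,1,2,\ldots\}$, and $\#$ denotes the cardinality of a set. *)

theory Defs
  imports Complex_Main "HOL-Library.FuncSet"
begin

(* A vector in N^m is a function on {1..m} that is undefined elsewhere (extensional), so that
   distinct functions are distinct vectors.  Only w 1, ..., w m are relevant. *)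
definition X :: "(nat \<Rightarrow> real) \<Rightarrow> real \<Rightarrow> nat \<Rightarrow> (nat \<Rightarrow> nat) set" where
  "X w q m = {\<alpha> \<in> {1..m} \<rightarrow>\<^sub>E (UNIV :: nat set). (\<Sum>n=1..m. real (\<alpha> n) * w n) \<le> q}"

end

theory Submission
  imports Defs
begin

text \<open>
  Splitting according to whether \<open>\<alpha>\<^sub>m = 0\<close> or \<open>\<alpha>\<^sub>m \<ge> 1\<close> gives
  \<open>#X(q, m) \<le> #X(q, m - 1) + #X(q - w\<^sub>m, m)\<close>. The claimed bound \<open>F\<^sub>m(q)\<close> satisfies the
  reverse inequality \<open>F\<^sub>m\<^sub>-\<^sub>1(q) + F\<^sub>m(q - w\<^sub>m) \<le> F\<^sub>m(q)\<close> for \<open>q \<ge> w\<^sub>m\<close>: it amounts to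
  \<open>(q + (m - 1) w\<^sub>m) F\<^sub>m\<^sub>-\<^sub>1(q - w\<^sub>m) \<le> q F\<^sub>m\<^sub>-\<^sub>1(q)\<close>, and since \<open>w\<^sub>n \<le> w\<^sub>m\<close>, the \<open>n\<close>-th factor of the
  quotient \<open>F\<^sub>m\<^sub>-\<^sub>1(q) / F\<^sub>m\<^sub>-\<^sub>1(q - w\<^sub>m)\<close> is at least \<open>(q + n w\<^sub>m) / (q + (n - 1) w\<^sub>m)\<close>, so that the
  product telescopes.
\<close>

lemma X_0: "X w q 0 = (if q \<ge> 0 then {\<lambda>_. undefined} else {})"
  by (auto simp: X_def)

lemma X_neg:
  assumes "q < 0" "\<forall>n\<in>{1..m}. w n > 0"
  shows "X w q m = {}"
proof -
  have nonneg: "0 \<le> (\<Sum>n=1..m. real (\<alpha> n) * w n)" for \<alpha> :: "nat \<Rightarrow> nat"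
    using assms(2) by (intro sum_nonneg mult_nonneg_nonneg) (auto intro: less_imp_le)
  then have "\<not> (\<Sum>n=1..m. real (\<alpha> n) * w n) \<le> q" for \<alpha> :: "nat \<Rightarrow> nat"
    using assms(1) nonneg[of \<alpha>] by linarith
  then show ?thesis
    by (simp add: X_def)
qed

text \<open>One map appends a zero in position \<open>Suc m\<close>, the other raises the last entry
  by one. Inclusion is enough for an upper bound on the cardinality.\<close>

lemma X_Suc_subset:
  "X w q (Suc m) \<subseteq> (\<lambda>\<alpha>. \<alpha>(Suc m := 0)) ` X w q m \<union>
     (\<lambda>\<alpha>. \<alpha>(Suc m := Suc (\<alpha> (Suc m)))) ` X w (q - w (Suc m)) (Suc m)"
proof
  fix \<alpha> assume "\<alpha> \<in> X w q (Suc m)"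
  then have ext: "\<alpha> \<in> extensional {1..Suc m}"
    and le: "(\<Sum>n=1..m. real (\<alpha> n) * w n) + real (\<alpha> (Suc m)) * w (Suc m) \<le> q"
    by (auto simp: X_def PiE_def)
  have sum_upd: "(\<Sum>n=1..m. real ((\<alpha>(Suc m := k)) n) * w n) = (\<Sum>n=1..m. real (\<alpha> n) * w n)" for k
    by (intro sum.cong) auto
  show "\<alpha> \<in> (\<lambda>\<alpha>. \<alpha>(Suc m := 0)) ` X w q m \<union>
     (\<lambda>\<alpha>. \<alpha>(Suc m := Suc (\<alpha> (Suc m)))) ` X w (q - w (Suc m)) (Suc m)"
  proof (cases "\<alpha> (Suc m)")
    case 0
    \<comment> \<open>Extensionality forces the value \<open>undefined\<close> at
      \<open>Suc m\<close>, which lies outside \<open>{1..m}\<close>.\<close>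
    have "\<alpha>(Suc m := undefined) \<in> X w q m"
      using ext le 0 sum_upd[of undefined] by (auto simp: X_def PiE_def extensional_def)
    moreover have "\<alpha> = (\<alpha>(Suc m := undefined))(Suc m := 0)"
      using 0 by auto
    ultimately show ?thesis by blast
  next
    case (Suc k)
    have "\<alpha>(Suc m := k) \<in> X w (q - w (Suc m)) (Suc m)"
      using ext le Suc sum_upd[of k] by (auto simp: X_def PiE_def extensional_def algebra_simps)
    moreover have "\<alpha> = (\<alpha>(Suc m := k))(Suc m := Suc ((\<alpha>(Suc m := k)) (Suc m)))"
      using Suc by auto
    ultimately show ?thesis by blast
  qed
qed

lemma card_X_Suc_le:
  assumes "finite (X w q m)" "finite (X w (q - w (Suc m)) (Suc m))"
  shows "finite (X w q (Suc m))"
    and "card (X w q (Suc m)) \<le> card (X w q m) + card (X w (q - w (Suc m)) (Suc m))"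
proof -
  show "finite (X w q (Suc m))"
    using finite_subset[OF X_Suc_subset] assms by blast
  show "card (X w q (Suc m)) \<le> card (X w q m) + card (X w (q - w (Suc m)) (Suc m))"
    by (rule order.trans[OF card_mono[OF _ X_Suc_subset]])
      (use assms in \<open>auto intro!: order.trans[OF card_Un_le] add_mono card_image_le\<close>)
qed

definition bound :: "(nat \<Rightarrow> real) \<Rightarrow> nat \<Rightarrow> real \<Rightarrow> real" where
  "bound w m t = (\<Prod>n=1..m. (t / (real n * w n) + 1))"

lemma bound_0 [simp]: "bound w 0 t = 1"
  by (simp add: bound_def)

lemma bound_Suc [simp]: "bound w (Suc m) t = bound w m t * (t / (real (Suc m) * w (Suc m)) + 1)"
  by (simp add: bound_def)

lemma bound_nonneg:
  assumes "t \<ge> 0" "\<forall>n\<in>{1..m}. w n > 0"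
  shows "bound w m t \<ge> 0"
  unfolding bound_def using assms
  by (intro prod_nonneg add_nonneg_nonneg divide_nonneg_nonneg mult_nonneg_nonneg)
    (auto intro: less_imp_le)

text \<open>The telescoping product, built up one factor at a time and cleared of denominators. The
  step \<open>v\<close> is kept separate from the weights, so that it stays fixed while
  \<open>m\<close> varies in the induction.\<close>

lemma bound_telescope:
  assumes "0 < v" "v \<le> t" "\<forall>n\<in>{1..m}. 0 < w n \<and> w n \<le> v"
  shows "(t + real m * v) * bound w m (t - v) \<le> t * bound w m t"
  using assms(3)
proof (induction m)
  case 0
  then show ?case by simp
next
  case (Suc m)
  define N where "N = real (Suc m)"
  define u where "u = w (Suc m)"
  have N: "N > 0" "real m = N - 1" by (auto simp: N_def)
  have u: "0 < u" "u \<le> v" using Suc.prems by (auto simp: u_def)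
  have IH: "(t + (N - 1) * v) * bound w m (t - v) \<le> t * bound w m t"
    using Suc.IH Suc.prems unfolding N(2) by simp
  \<comment> \<open>Cross-multiplied comparison of the new factor of the quotient with
    \<open>(t + N * v) / (t + (N - 1) * v)\<close>; its sign is decided by
    \<open>u \<le> v\<close>.\<close>
  have "(t + (N - 1) * v) * (t + N * u) - (t + N * v) * (t - v + N * u) = N * v * (v - u)"
    by (simp add: algebra_simps)
  also have "\<dots> \<ge> 0" using N u assms(1) by simp
  finally have "(t + N * v) * (t - v + N * u) / (N * u) \<le> (t + (N - 1) * v) * (t + N * u) / (N * u)"
    using N u by (intro divide_right_mono) auto
  moreover have "x / (N * u) + 1 = (x + N * u) / (N * u)" for x
    using N u by (simp add: add_divide_distrib)
  ultimately have factor: "(t + N * v) * ((t - v) / (N * u) + 1) \<le> (t + (N - 1) * v) * (t / (N * u) + 1)"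
    by (simp only: times_divide_eq_right)
  have "(t + N * v) * bound w (Suc m) (t - v) = bound w m (t - v) * ((t + N * v) * ((t - v) / (N * u) + 1))"
    by (simp only: bound_Suc mult_ac flip: N_def u_def)
  also have "\<dots> \<le> bound w m (t - v) * ((t + (N - 1) * v) * (t / (N * u) + 1))"
    using factor Suc.prems assms(2) by (intro mult_left_mono bound_nonneg) auto
  also have "\<dots> = ((t + (N - 1) * v) * bound w m (t - v)) * (t / (N * u) + 1)"
    by (simp only: mult_ac)
  also have "\<dots> \<le> t * bound w m t * (t / (N * u) + 1)"
    using IH N u assms by (intro mult_right_mono) auto
  also have "\<dots> = t * bound w (Suc m) t"
    by (simp only: bound_Suc mult_ac flip: N_def u_def)
  finally show ?case by (simp only: N_def)
qed

lemma bound_recurrence: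
  assumes "\<forall>n\<in>{1..Suc m}. 0 < w n \<and> w n \<le> w (Suc m)" "w (Suc m) \<le> t"
  shows "bound w m t + bound w (Suc m) (t - w (Suc m)) \<le> bound w (Suc m) t"
proof -
  define v where "v = w (Suc m)"
  define N where "N = real (Suc m)"
  have pos: "v > 0" "N > 0" and m: "real m = N - 1" using assms by (auto simp: v_def N_def)
  \<comment> \<open>Shifting by \<open>v\<close> turns the numerator \<open>t + N * v\<close> of the
    last factor into the multiplier of \<open>bound_telescope\<close>.\<close>
  have "(t - v) / (N * v) + 1 = (t + real m * v) / (N * v)"
    unfolding m using pos by (simp add: field_simps)
  then have "bound w (Suc m) (t - v) = (t + real m * v) * bound w m (t - v) / (N * v)"
    by (simp only: bound_Suc times_divide_eq_right mult.commute flip: v_def N_def)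
  also have "\<dots> \<le> t * bound w m t / (N * v)"
    using pos assms[folded v_def] by (intro divide_right_mono bound_telescope) auto
  also have "\<dots> = bound w (Suc m) t - bound w m t"
    unfolding bound_Suc v_def[symmetric] N_def[symmetric] by (simp add: algebra_simps)
  finally show ?thesis by (simp add: v_def)
qed

text \<open>Finiteness is carried through the induction because \<open>card\<close> is 0 on infinite
  sets and \<open>card_X_Suc_le\<close> needs both smaller sets finite.\<close>

lemma card_X_le_bound:
  assumes "q \<ge> 0" "\<forall>n\<in>{1..m}. w n > 0" "mono_on {1..m} w"
  shows "finite (X w q m) \<and> real (card (X w q m)) \<le> bound w m q"
  using assms
proof (induction m arbitrary: q)
  case 0
  then show ?case by (simp add: X_0)
next
  case (Suc m)
  define v where "v = w (Suc m)"
  have v: "v > 0" using Suc.prems by (simp add: v_def)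
  have le_v: "\<forall>n\<in>{1..Suc m}. 0 < w n \<and> w n \<le> w (Suc m)"
    using Suc.prems(2,3) by (auto intro: mono_onD)
  have "mono_on {1..m} w"
    using Suc.prems(3) by (rule mono_on_subset) auto
  with Suc have IH: "finite (X w t m) \<and> real (card (X w t m)) \<le> bound w m t" if "t \<ge> 0" for t
    using that by simp
  from \<open>q \<ge> 0\<close> show ?case
  \<comment> \<open>At fixed dimension the recursion replaces the real number \<open>q\<close> by
    \<open>q - v\<close>; the natural number \<open>nat \<lfloor>q / v\<rfloor>\<close> then drops,
    which makes this well-founded.\<close>
  proof (induction "nat \<lfloor>q / v\<rfloor>" arbitrary: q rule: less_induct)
    case less
    note rec = card_X_Suc_le[of w q m, folded v_def]
    show ?case
    proof (cases "v \<le> q")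
      case True
      have "nat \<lfloor>(q - v) / v\<rfloor> < nat \<lfloor>q / v\<rfloor>"
        using v True by (simp add: diff_divide_distrib)
      with less.hyps True have step: "finite (X w (q - v) (Suc m))"
          "real (card (X w (q - v) (Suc m))) \<le> bound w (Suc m) (q - v)"
        by auto
      have "bound w m q + bound w (Suc m) (q - v) \<le> bound w (Suc m) q"
        using bound_recurrence[OF le_v] True by (simp only: v_def)
      with step rec IH[OF less.prems] show ?thesis by (auto simp del: bound_Suc)
    next
      case False
      then have "X w (q - v) (Suc m) = {}"
        using Suc.prems by (intro X_neg) auto
      moreover have "bound w m q \<le> bound w (Suc m) q"
        using mult_left_mono[OF _ bound_nonneg, of 1 "q / (real (Suc m) * v) + 1" q m w]
          less.prems Suc.prems(2) v by (simp del: of_nat_Suc flip: v_def)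
      ultimately show ?thesis using rec IH[OF less.prems] by (auto simp del: bound_Suc)
    qed
  qed
qed

theorem lemma5p3:
  fixes m :: nat and q :: real and w :: "nat \<Rightarrow> real"
  assumes "m \<ge> 1"
    and "q \<ge> 0"
    and "\<forall>n\<in>{1..m}. w n > 0"
    and "mono_on {1..m} w"
  shows "finite (X w q m) \<and> real (card (X w q m)) \<le> (\<Prod>n=1..m. (q / (real n * w n) + 1))"
  using card_X_le_bound[OF assms(2-4)] by (simp only: bound_def)

end
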